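(* Let $S:\mathbb{R}^n\rightrightarrows\mathbb{R}^m$ be a polyhedral multifunction, let $Q$ be a convex subset of $\operatorname{dom} S$, and let $\kappa$ be the calmness modulus of $S$ on $Q$. Let $(\bar q,\bar x)\in\operatorname{gph} S|_Q$. Consider the statements: (i) $S$ is inner semicontinuous around $(\bar q,\bar x)$ relative to $Q$; (ii) $S$ is Lipschitz-like relative to $Q$ at $\bar q$ for $\bar x$ with modulus $\kappa$; (iii) $S$ is locally Lipschitz continuous relative to $Q$ around $(\bar q,\bar x)$ with modulus $\kappa$. Then (i) $\Longleftrightarrow$ (ii) $\Longleftarrow$ (iii).
   Context: $\operatorname{gph} S=\{(q,x)\mid x\in S(q)\}$, $\operatorname{dom} S=\{q\mid S(q)\ne\emptyset\}$, $S|_Q(q)=S(q)$ if $q\in Q$ and $\emptyset$ otherwise. $\mathbb{B}$ is the closed unit ball and $\mathbb{B}_\rho(q)$ the closed ball of radius $\rho$ around $q$. A multifunction is polyhedral if its graph is a union of finitely many polyhedral sets (intersections of finitely many closed half-spaces). Calmness modulus $\kappa$ of $S$ on $Q$: a constant $\kappa\ge0$, the same for all points of $Q$, such that for each $q\in Q$ there is $\rho>0$ with $S(q')\subseteq S(q)+\kappa\|q'-q\|\mathbb{B}$ for all $q'\in Q\cap\mathbb{B}_\rho(q)$ (such a constant exists for polyhedral multifunctions). Inner semicontinuity: $S$ is inner semicontinuous (isc) at $(q,x)\in\operatorname{gph} S|_Q$ relative to $Q$ if $x\in\liminf_{q'\to q,\,q'\in Q}S(q')$ (inner limit: for every sequence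 $q_k\to q$ in $Q$ there are, for all large $k$, $x_k\in S(q_k)$ with $x_k\to x$). $S$ is isc around $(\bar q,\bar x)$ relative to $Q$ if there are neighborhoods $V$ of $\bar q$ and $W$ of $\bar x$ such that $S$ is isc relative to $Q$ at every $(q,x)\in\operatorname{gph} S|_Q\cap(V\times W)$. Lipschitz-like relative to $Q$ at $\bar q$ for $\bar x$ with modulus $\kappa$: $\operatorname{gph} S$ is locally closed at $(\bar q,\bar x)$ and there are neighborhoods $V$ of $\bar q$, $W$ of $\bar x$ with $S(q')\cap W\subset S(q)+\kappa\|q'-q\|\mathbb{B}$ for all $q,q'\in Q\cap V$. Locally Lipschitz continuous relative to $Q$ around $(\bar q,\bar x)$ with modulus $\kappa$: as in the previous definition, with the inclusion replaced by $S(q')\cap W\subset S(q)\cap W+\kappa\|q'-q\|\mathbb{B}$ for all $q,q'\in Q\cap V$. *)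

theory Defs
  imports "HOL-Analysis.Analysis" "HOL-Library.Set_Algebras"
begin

text \<open>A multifunction from \<open>'a\<close> to \<open>'b\<close> is a function \<open>'a \<Rightarrow> 'b set\<close>.\<close>

definition gph :: "('a \<Rightarrow> 'b set) \<Rightarrow> ('a \<times> 'b) set" where
  "gph S = {(q, x). x \<in> S q}"

definition mdom :: "('a \<Rightarrow> 'b set) \<Rightarrow> 'a set" where
  "mdom S = {q. S q \<noteq> {}}"

definition mrestrict :: "('a \<Rightarrow> 'b set) \<Rightarrow> 'a set \<Rightarrow> 'a \<Rightarrow> 'b set" where
  "mrestrict S Q = (\<lambda>q. if q \<in> Q then S q else {})"

definition polyhedral_multifunction ::
    "('a::euclidean_space \<Rightarrow> 'b::euclidean_space set) \<Rightarrow> bool" where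
  "polyhedral_multifunction S \<longleftrightarrow>
     (\<exists>F. finite F \<and> (\<forall>P\<in>F. polyhedron P) \<and> gph S = \<Union>F)"

definition scaled_ball :: "real \<Rightarrow> 'b::real_normed_vector set" where
  "scaled_ball r = (\<lambda>b. r *\<^sub>R b) ` cball 0 1"

text \<open>Any admissible constant counts as a calmness modulus; it need not be the least one.
  The constant is uniform over \<open>Q\<close>, whereas the radius \<open>\<rho>\<close> may depend on the point.\<close>

definition calmness_modulus_on ::
    "real \<Rightarrow> ('a::real_normed_vector \<Rightarrow> 'b::real_normed_vector set) \<Rightarrow> 'a set \<Rightarrow> bool" where
  "calmness_modulus_on \<kappa> S Q \<longleftrightarrow> 0 \<le> \<kappa> \<and>
     (\<forall>q\<in>Q. \<exists>\<rho>>0. \<forall>q'\<in>Q \<inter> cball q \<rho>. S q' \<subseteq> S q + scaled_ball (\<kappa> * norm (q' - q)))"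

definition inner_limit ::
    "('a::topological_space \<Rightarrow> 'b::topological_space set) \<Rightarrow> 'a set \<Rightarrow> 'a \<Rightarrow> 'b set" where
  "inner_limit S Q q = {x. \<forall>qs::nat \<Rightarrow> 'a. (\<forall>k. qs k \<in> Q) \<and> qs \<longlonglongrightarrow> q \<longrightarrow>
     (\<exists>xs. (\<forall>\<^sub>F k in sequentially. xs k \<in> S (qs k)) \<and> xs \<longlonglongrightarrow> x)}"

definition isc_at_rel ::
    "('a::topological_space \<Rightarrow> 'b::topological_space set) \<Rightarrow> 'a set \<Rightarrow> 'a \<Rightarrow> 'b \<Rightarrow> bool" where
  "isc_at_rel S Q q x \<longleftrightarrow> x \<in> inner_limit S Q q"

text \<open>Neighborhoods of a point are arbitrary (not necessarily open) sets having it in their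
  interior. This matters for \<open>locally_lipschitz_rel\<close>, where \<open>W\<close> occurs on both sides of the
  inclusion.\<close>

definition isc_around_rel ::
    "('a::topological_space \<Rightarrow> 'b::topological_space set) \<Rightarrow> 'a set \<Rightarrow> 'a \<Rightarrow> 'b \<Rightarrow> bool" where
  "isc_around_rel S Q q0 x0 \<longleftrightarrow>
     (\<exists>V W. q0 \<in> interior V \<and> x0 \<in> interior W \<and>
        (\<forall>(q, x) \<in> gph (mrestrict S Q) \<inter> (V \<times> W). isc_at_rel S Q q x))"

definition locally_closed_at :: "'a::topological_space set \<Rightarrow> 'a \<Rightarrow> bool" where
  "locally_closed_at C z \<longleftrightarrow> (\<exists>U. closed U \<and> z \<in> interior U \<and> closed (C \<inter> U))"

definition lipschitz_like_rel ::
    "('a::real_normed_vector \<Rightarrow> 'b::real_normed_vector set) \<Rightarrow> 'a set \<Rightarrow> 'a \<Rightarrow> 'b \<Rightarrow> real \<Rightarrow> bool" where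
  "lipschitz_like_rel S Q q0 x0 \<kappa> \<longleftrightarrow>
     locally_closed_at (gph S) (q0, x0) \<and>
     (\<exists>V W. q0 \<in> interior V \<and> x0 \<in> interior W \<and>
        (\<forall>q\<in>Q \<inter> V. \<forall>q'\<in>Q \<inter> V. S q' \<inter> W \<subseteq> S q + scaled_ball (\<kappa> * norm (q' - q))))"

definition locally_lipschitz_rel ::
    "('a::real_normed_vector \<Rightarrow> 'b::real_normed_vector set) \<Rightarrow> 'a set \<Rightarrow> 'a \<Rightarrow> 'b \<Rightarrow> real \<Rightarrow> bool" where
  "locally_lipschitz_rel S Q q0 x0 \<kappa> \<longleftrightarrow>
     locally_closed_at (gph S) (q0, x0) \<and>
     (\<exists>V W. q0 \<in> interior V \<and> x0 \<in> interior W \<and>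
        (\<forall>q\<in>Q \<inter> V. \<forall>q'\<in>Q \<inter> V. S q' \<inter> W \<subseteq> (S q \<inter> W) + scaled_ball (\<kappa> * norm (q' - q))))"

end

theory Submission
  imports Defs
begin

text \<open>
  The interesting implication is from inner semicontinuity to the Lipschitz-like property.
  For \<open>q\<close>, \<open>q'\<close> near \<open>q0\<close>, let \<open>x\<close> near \<open>x0\<close> lie in \<open>S q'\<close>, move from \<open>q'\<close> to \<open>q\<close> along the
  segment \<open>p s = q' + s (q - q')\<close>, and let \<open>h s\<close> be the distance from \<open>x\<close> to \<open>S (p s)\<close> minus
  \<open>\<kappa> s \<parallel>q - q'\<parallel>\<close>. Calmness at \<open>p s\<close> compares \<open>S (p s)\<close> with \<open>S (p u)\<close> for \<open>u < s\<close> close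
  to \<open>s\<close> and gives \<open>h s \<le> h u\<close>. Inner semicontinuity at a point of \<open>S (p s)\<close> nearest to \<open>x\<close>
  makes \<open>h\<close> upper semicontinuous from the right, as long as that point stays near \<open>x0\<close>.
  Together these force \<open>h 1 \<le> h 0 = 0\<close>, which is the desired estimate.
\<close>

section \<open>Balls, closed graphs and the epsilon-delta form of inner semicontinuity\<close>

lemma scaled_ball_eq_cball:
  assumes "0 \<le> r"
  shows "scaled_ball r = cball (0::'a::real_normed_vector) r"
  using cball_scale[of r "0::'a" 1] assms
  by (cases "r = 0") (auto simp: scaled_ball_def image_constant_conv)

lemma mem_plus_scaled_ball_iff:
  assumes "0 \<le> r"
  shows "y \<in> A + scaled_ball r \<longleftrightarrow> (\<exists>a\<in>A. dist y a \<le> r)"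
proof -
  have "y \<in> A + cball 0 r \<longleftrightarrow> (\<exists>a\<in>A. dist y a \<le> r)"
  proof
    assume "\<exists>a\<in>A. dist y a \<le> r"
    then obtain a where "a \<in> A" "dist y a \<le> r" by blast
    then have "a + (y - a) \<in> A + cball 0 r"
      by (intro set_plus_intro) (auto simp: mem_cball_0 dist_norm simp del: mem_cball)
    then show "y \<in> A + cball 0 r" by simp
  qed (force simp: set_plus_def dist_norm)
  then show ?thesis
    using assms by (simp add: scaled_ball_eq_cball)
qed

text \<open>This is how polyhedrality enters: a closed graph gives local closedness at once and,
  through closed values, distances that are attained.\<close>

lemma closed_gph_polyhedral:
  assumes "polyhedral_multifunction S"
  shows "closed (gph S)"
  using assms unfolding polyhedral_multifunction_def by (metis closed_Union polyhedron_imp_closed)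

lemma closed_value_of_closed_gph:
  fixes S :: "'a::t1_space \<Rightarrow> 'b::topological_space set"
  assumes "closed (gph S)"
  shows "closed (S q)"
proof -
  have "closed ((\<lambda>x. (q, x)) -` gph S)"
    by (intro closed_vimage assms continuous_intros)
  moreover have "(\<lambda>x. (q, x)) -` gph S = S q"
    by (auto simp: gph_def)
  ultimately show ?thesis by simp
qed

text \<open>If every radius 1/(k+1) failed, the offending points would form a sequence in
  \<open>Q\<close> converging to \<open>q\<close> along which \<open>S\<close> has no values within
  \<open>e\<close> of \<open>x\<close>.\<close>

lemma isc_at_relD:
  fixes S :: "'a::metric_space \<Rightarrow> 'b::metric_space set"
  assumes "isc_at_rel S Q q x" and "0 < e"
  shows "\<exists>d>0. \<forall>q'\<in>Q. dist q' q < d \<longrightarrow> (\<exists>x'\<in>S q'. dist x' x < e)"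
proof (rule ccontr)
  assume "\<not> ?thesis"
  moreover have "0 < inverse (real (Suc k))" for k by simp
  ultimately have "\<forall>k. \<exists>q'\<in>Q. dist q' q < inverse (real (Suc k)) \<and> (\<forall>x'\<in>S q'. \<not> dist x' x < e)"
    by blast
  then obtain qs where qs: "\<And>k. qs k \<in> Q" "\<And>k. dist (qs k) q < inverse (real (Suc k))"
    "\<And>k x'. x' \<in> S (qs k) \<Longrightarrow> \<not> dist x' x < e"
    by metis
  have "qs \<longlonglongrightarrow> q"
    by (rule metric_tendsto_imp_tendsto[OF LIMSEQ_inverse_real_of_nat])
       (use qs(2) in \<open>auto intro!: always_eventually less_imp_le\<close>)
  then obtain xs where "\<forall>\<^sub>F k in sequentially. xs k \<in> S (qs k)" "xs \<longlonglongrightarrow> x"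
    using assms(1) qs(1) unfolding isc_at_rel_def inner_limit_def by blast
  then have "\<forall>\<^sub>F k in sequentially. xs k \<in> S (qs k) \<and> dist (xs k) x < e"
    using \<open>0 < e\<close> by (intro eventually_conj tendstoD)
  then show False
    using qs(3) by (auto dest!: eventually_happens)
qed

section \<open>Descent on a real interval and the distance estimate along a segment\<close>

lemma real_le_by_left_descent:
  fixes h :: "real \<Rightarrow> real"
  assumes "a \<le> b"
    and left: "\<And>s. \<lbrakk>a < s; s \<le> b\<rbrakk> \<Longrightarrow> \<exists>\<rho>>0. \<forall>u. a \<le> u \<and> s - \<rho> < u \<and> u < s \<longrightarrow> h s \<le> h u"
    and right: "\<And>s. \<lbrakk>a \<le> s; s < b; h s < h b\<rbrakk> \<Longrightarrow> \<exists>\<rho>>0. \<forall>u. s < u \<and> u < s + \<rho> \<and> u \<le> b \<longrightarrow> h u < h b"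
  shows "h b \<le> h a"
proof -
  \<comment> \<open>Real induction from \<open>b\<close> down to \<open>a\<close>:
    \<open>right\<close> shows that the infimum \<open>t\<close> of \<open>A\<close> still satisfies
    \<open>h b \<le> h t\<close>, and \<open>left\<close> extends \<open>A\<close> below
    \<open>t\<close> unless \<open>t = a\<close>.\<close>
  define A where "A = {s. a \<le> s \<and> s \<le> b \<and> (\<forall>u. s \<le> u \<and> u \<le> b \<longrightarrow> h b \<le> h u)}"
  define t where "t = Inf A"
  have "b \<in> A"
    using \<open>a \<le> b\<close> by (auto simp: A_def antisym)
  have bdd: "bdd_below A"
    by (auto simp: A_def intro!: bdd_belowI)
  have "a \<le> t"
    unfolding t_def using \<open>b \<in> A\<close> by (intro cInf_greatest) (auto simp: A_def)
  have "t \<le> b"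
    unfolding t_def using \<open>b \<in> A\<close> bdd by (intro cInf_lower)
  have above: "h b \<le> h u" if "t < u" "u \<le> b" for u
  proof -
    obtain s where "s \<in> A" "s < u"
      using \<open>t < u\<close> \<open>b \<in> A\<close> cInf_lessD[of A u] unfolding t_def by blast
    then show ?thesis using that by (auto simp: A_def)
  qed
  have ht: "h b \<le> h t"
  proof (rule ccontr)
    assume neg: "\<not> h b \<le> h t"
    then have "t < b" using \<open>t \<le> b\<close> by (cases "t = b") auto
    then obtain \<rho> where "0 < \<rho>" and \<rho>: "\<And>u. t < u \<Longrightarrow> u < t + \<rho> \<Longrightarrow> u \<le> b \<Longrightarrow> h u < h b"
      using right[of t] neg \<open>a \<le> t\<close> by (auto simp: not_le)
    obtain u where "t < u" "u < min b (t + \<rho>)"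
      using dense[of t "min b (t + \<rho>)"] \<open>t < b\<close> \<open>0 < \<rho>\<close> by auto
    then show False
      using \<rho>[of u] above[of u] by auto
  qed
  have "t = a"
  proof (rule ccontr)
    assume "t \<noteq> a"
    then have "a < t" using \<open>a \<le> t\<close> by simp
    then obtain \<rho> where "0 < \<rho>" and \<rho>: "\<And>u. a \<le> u \<Longrightarrow> t - \<rho> < u \<Longrightarrow> u < t \<Longrightarrow> h t \<le> h u"
      using left[of t] \<open>t \<le> b\<close> by blast
    obtain v where v: "max a (t - \<rho>) < v" "v < t"
      using dense[of "max a (t - \<rho>)" t] \<open>a < t\<close> \<open>0 < \<rho>\<close> by auto
    have "h b \<le> h u" if "v \<le> u" "u \<le> b" for u
    proof (cases u t rule: linorder_cases)
      case less
      then show ?thesis using \<rho>[of u] v that ht by auto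
    qed (use above ht that in auto)
    then have "v \<in> A"
      using v \<open>t \<le> b\<close> by (auto simp: A_def)
    then have "t \<le> v"
      unfolding t_def using bdd by (rule cInf_lower)
    with v show False by simp
  qed
  with ht show ?thesis by simp
qed

text \<open>The calmness radius may have no positive lower bound along the segment, so calmness
  cannot be chained over a fixed subdivision; the descent lemma replaces the chaining. Inner
  semicontinuity is asked only at points nearer to \<open>x\<close> than \<open>S q\<close>, which
  keeps the argument local in the range space.\<close>

lemma infdist_calm_segment:
  fixes S :: "'a::real_normed_vector \<Rightarrow> 'b::euclidean_space set"
  assumes "0 \<le> \<kappa>" and "convex Q" and closed: "\<And>q. q \<in> Q \<Longrightarrow> closed (S q)"
    and nonempty: "\<And>q. q \<in> Q \<Longrightarrow> S q \<noteq> {}"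
    and calm: "\<And>q. q \<in> Q \<Longrightarrow> \<exists>\<rho>>0. \<forall>q'\<in>Q \<inter> cball q \<rho>. S q' \<subseteq> S q + scaled_ball (\<kappa> * norm (q' - q))"
    and "q \<in> Q" and "q' \<in> Q" and "x \<in> S q'"
    and isc: "\<And>p y. \<lbrakk>p \<in> closed_segment q' q; y \<in> S p; dist x y < infdist x (S q)\<rbrakk> \<Longrightarrow> isc_at_rel S Q p y"
  shows "infdist x (S q) \<le> \<kappa> * norm (q' - q)"
proof -
  define d where "d = norm (q - q')"
  define p where "p s = q' + s *\<^sub>R (q - q')" for s
  define h where "h s = infdist x (S (p s)) - \<kappa> * s * d" for s
  have pseg: "p s \<in> closed_segment q' q" if "0 \<le> s" "s \<le> 1" for s
    using that by (auto simp: p_def closed_segment_def algebra_simps intro!: exI[of _ s])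
  then have pQ: "p s \<in> Q" if "0 \<le> s" "s \<le> 1" for s
    using that closed_segment_subset[OF \<open>q' \<in> Q\<close> \<open>q \<in> Q\<close> \<open>convex Q\<close>] by blast
  have pdist: "dist (p s) (p u) = \<bar>s - u\<bar> * d" for s u
    by (simp add: p_def d_def dist_norm flip: scaleR_left_diff_distrib)
  have "0 \<le> d" by (simp add: d_def)
  have p1: "p 1 = q" and p0: "p 0 = q'" by (simp_all add: p_def)
  \<comment> \<open>The divisor \<open>d + 1\<close> stays positive when
    \<open>q = q'\<close>.\<close>
  have near: "\<exists>\<delta>>0. \<forall>u. \<bar>u - s\<bar> < \<delta> \<longrightarrow> dist (p u) (p s) < \<rho>" if "0 < \<rho>" for \<rho> s
  proof (intro exI[of _ "\<rho> / (d + 1)"] conjI allI impI)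
    show "0 < \<rho> / (d + 1)" using that \<open>0 \<le> d\<close> by simp
    fix u assume "\<bar>u - s\<bar> < \<rho> / (d + 1)"
    then have "\<bar>u - s\<bar> * (d + 1) < \<rho>"
      using \<open>0 \<le> d\<close> by (simp add: pos_less_divide_eq)
    then show "dist (p u) (p s) < \<rho>"
      by (simp add: pdist distrib_left)
  qed
  have "h 1 \<le> h 0"
  proof (rule real_le_by_left_descent[where h = h and a = 0 and b = 1])
    \<comment> \<open>Calmness is centred at the later point \<open>p s\<close>: a point of
      \<open>S (p u)\<close> nearest to \<open>x\<close> is moved into \<open>S (p s)\<close> at
      cost at most \<open>\<kappa> * (s - u) * d\<close>, exactly the change in the linear term of
      \<open>h\<close>.\<close>
    fix s :: real
    assume s: "0 < s" "s \<le> 1"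
    obtain \<rho> where "0 < \<rho>" and
      \<rho>: "\<And>q'. q' \<in> Q \<Longrightarrow> dist q' (p s) < \<rho> \<Longrightarrow> S q' \<subseteq> S (p s) + scaled_ball (\<kappa> * norm (q' - p s))"
      using calm[OF pQ, of s] s by (force simp: dist_commute)
    obtain \<delta> where "0 < \<delta>" and \<delta>: "\<And>u. \<bar>u - s\<bar> < \<delta> \<Longrightarrow> dist (p u) (p s) < \<rho>"
      using near[OF \<open>0 < \<rho>\<close>] by blast
    have "h s \<le> h u" if u: "0 \<le> u" "s - \<delta> < u" "u < s" for u
    proof -
      have "p u \<in> Q" using u s by (intro pQ) auto
      then obtain y where y: "y \<in> S (p u)" "infdist x (S (p u)) = dist x y"
        using infdist_attains_inf[OF closed nonempty] by blast
      then have "y \<in> S (p s) + scaled_ball (\<kappa> * norm (p u - p s))"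
        using \<rho>[OF \<open>p u \<in> Q\<close> \<delta>] u by auto
      then obtain z where z: "z \<in> S (p s)" "dist y z \<le> \<kappa> * norm (p u - p s)"
        using \<open>0 \<le> \<kappa>\<close> by (auto simp: mem_plus_scaled_ball_iff)
      have "infdist x (S (p s)) \<le> dist x z"
        using z by (intro infdist_le)
      also have "\<dots> \<le> dist x y + dist y z"
        by (rule dist_triangle)
      also have "\<dots> \<le> infdist x (S (p u)) + \<kappa> * ((s - u) * d)"
        using y z u pdist[of u s] by (auto simp: dist_norm)
      finally show ?thesis
        by (simp add: h_def algebra_simps)
    qed
    then show "\<exists>\<delta>>0. \<forall>u. 0 \<le> u \<and> s - \<delta> < u \<and> u < s \<longrightarrow> h s \<le> h u"
      using \<open>0 < \<delta>\<close> by blast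
  next
    fix s :: real
    assume s: "0 \<le> s" "s < 1" "h s < h 1"
    have "p s \<in> Q" using s by (intro pQ) auto
    then obtain y where y: "y \<in> S (p s)" "infdist x (S (p s)) = dist x y"
      using infdist_attains_inf[OF closed nonempty] by blast
    have mono: "\<kappa> * u * d \<le> \<kappa> * v * d" if "u \<le> v" for u v
      using that \<open>0 \<le> \<kappa>\<close> \<open>0 \<le> d\<close> by (intro mult_right_mono mult_left_mono)
    \<comment> \<open>As \<open>\<kappa> * s * d \<le> \<kappa> * d\<close>, the inequality
      \<open>h s < h 1\<close> passes to the distances themselves.\<close>
    have "dist x y < infdist x (S q)"
      using s mono[of s 1] y by (simp add: h_def p1)
    then have "isc_at_rel S Q (p s) y"
      using isc y pseg s by auto
    \<comment> \<open>The gap \<open>h 1 - h s\<close> is the tolerance: the distance grows by less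
      than this, and the linear term does not increase \<open>h\<close> to the right of
      \<open>s\<close>.\<close>
    then obtain \<rho> where "0 < \<rho>" and
      \<rho>: "\<And>q'. q' \<in> Q \<Longrightarrow> dist q' (p s) < \<rho> \<Longrightarrow> \<exists>x'\<in>S q'. dist x' y < h 1 - h s"
      using isc_at_relD[of S Q "p s" y "h 1 - h s"] s by auto
    obtain \<delta> where "0 < \<delta>" and \<delta>: "\<And>u. \<bar>u - s\<bar> < \<delta> \<Longrightarrow> dist (p u) (p s) < \<rho>"
      using near[OF \<open>0 < \<rho>\<close>] by blast
    have "h u < h 1" if u: "s < u" "u < s + \<delta>" "u \<le> 1" for u
    proof -
      have "p u \<in> Q" using u s by (intro pQ) auto
      then obtain z where z: "z \<in> S (p u)" "dist z y < h 1 - h s"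
        using \<rho> \<delta>[of u] u by force
      have "infdist x (S (p u)) \<le> dist x z"
        using z by (intro infdist_le)
      also have "\<dots> \<le> dist x y + dist z y"
        by (rule dist_triangle2)
      finally show ?thesis
        using z y mono[of s u] u by (simp add: h_def)
    qed
    then show "\<exists>\<delta>>0. \<forall>u. s < u \<and> u < s + \<delta> \<and> u \<le> 1 \<longrightarrow> h u < h 1"
      using \<open>0 < \<delta>\<close> by blast
  qed simp
  then show ?thesis
    using \<open>x \<in> S q'\<close> by (simp add: h_def p0 p1 d_def norm_minus_commute)
qed

section \<open>The implications between the three properties\<close>

lemma isc_around_rel_if_lipschitz_like_rel:
  assumes "0 \<le> \<kappa>" and "lipschitz_like_rel S Q q0 x0 \<kappa>"
  shows "isc_around_rel S Q q0 x0"
proof -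
  obtain V W where V: "q0 \<in> interior V" and W: "x0 \<in> interior W"
    and lip: "\<And>q q'. \<lbrakk>q \<in> Q \<inter> V; q' \<in> Q \<inter> V\<rbrakk> \<Longrightarrow> S q' \<inter> W \<subseteq> S q + scaled_ball (\<kappa> * norm (q' - q))"
    using assms(2) unfolding lipschitz_like_rel_def by blast
  \<comment> \<open>\<open>V\<close> is shrunk to its interior so that sequences converging to
    \<open>q\<close> eventually lie in it. \<open>W\<close> can stay, since only the fixed point
    \<open>x\<close> must belong to it.\<close>
  have "x \<in> inner_limit S Q q" if q: "q \<in> Q" "q \<in> interior V" and x: "x \<in> S q" "x \<in> W" for q x
    unfolding inner_limit_def
  proof (intro CollectI allI impI)
    fix qs assume qs: "(\<forall>k. qs k \<in> Q) \<and> qs \<longlonglongrightarrow> q"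
    have "\<forall>\<^sub>F k in sequentially. qs k \<in> interior V"
      using qs q by (auto intro: topological_tendstoD)
    moreover have "\<exists>y\<in>S (qs k). dist x y \<le> \<kappa> * norm (q - qs k)" if "qs k \<in> interior V" for k
    proof -
      \<comment> \<open>The limit \<open>q\<close> plays the perturbed point and \<open>qs k\<close>
        the base point, so that \<open>x\<close> is approximated from
        \<open>S (qs k)\<close>.\<close>
      have "x \<in> S (qs k) + scaled_ball (\<kappa> * norm (q - qs k))"
        using lip[of "qs k" q] that q x qs interior_subset[of V] by blast
      then show ?thesis
        using \<open>0 \<le> \<kappa>\<close> by (simp add: mem_plus_scaled_ball_iff)
    qed
    then obtain xs where xs: "\<And>k. qs k \<in> interior V \<Longrightarrow> xs k \<in> S (qs k) \<and> dist x (xs k) \<le> \<kappa> * norm (q - qs k)"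
      by metis
    ultimately have ev: "\<forall>\<^sub>F k in sequentially. xs k \<in> S (qs k) \<and> dist x (xs k) \<le> \<kappa> * norm (q - qs k)"
      by (rule eventually_mono)
    have "(\<lambda>k. \<kappa> * norm (q - qs k)) \<longlonglongrightarrow> \<kappa> * norm (q - q)"
      using qs by (intro tendsto_intros) auto
    then have lim0: "(\<lambda>k. \<kappa> * norm (q - qs k)) \<longlonglongrightarrow> 0" by simp
    have "xs \<longlonglongrightarrow> x"
      by (rule metric_tendsto_imp_tendsto[OF lim0])
         (use ev in \<open>auto elim!: eventually_mono simp: dist_commute\<close>)
    then show "\<exists>xs. (\<forall>\<^sub>F k in sequentially. xs k \<in> S (qs k)) \<and> xs \<longlonglongrightarrow> x"
      using ev by (auto elim: eventually_mono)
  qed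
  then show ?thesis
    unfolding isc_around_rel_def isc_at_rel_def using V W
    by (intro exI[of _ "interior V"] exI[of _ W])
       (auto simp: gph_def mrestrict_def split: if_splits)
qed

lemma lipschitz_like_rel_if_isc_around_rel:
  fixes S :: "'a::real_normed_vector \<Rightarrow> 'b::euclidean_space set"
  assumes "closed (gph S)" and "convex Q" and "Q \<subseteq> mdom S" and "calmness_modulus_on \<kappa> S Q"
    and "q0 \<in> Q" and "x0 \<in> S q0" and "isc_around_rel S Q q0 x0"
  shows "lipschitz_like_rel S Q q0 x0 \<kappa>"
proof -
  have "0 \<le> \<kappa>" and calm: "\<And>q. q \<in> Q \<Longrightarrow> \<exists>\<rho>>0. \<forall>q'\<in>Q \<inter> cball q \<rho>. S q' \<subseteq> S q + scaled_ball (\<kappa> * norm (q' - q))"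
    using assms(4) by (auto simp: calmness_modulus_on_def)
  have closed: "closed (S q)" for q
    using assms(1) by (rule closed_value_of_closed_gph)
  have nonempty: "S q \<noteq> {}" if "q \<in> Q" for q
    using assms(3) that by (auto simp: mdom_def)
  obtain V W where "q0 \<in> interior V" and "x0 \<in> interior W"
    and isc: "\<And>q x. \<lbrakk>q \<in> Q; q \<in> V; x \<in> S q; x \<in> W\<rbrakk> \<Longrightarrow> isc_at_rel S Q q x"
    using assms(7) by (fastforce simp: isc_around_rel_def gph_def mrestrict_def)
  then obtain r1 r2 where "0 < r1" "ball q0 r1 \<subseteq> V" and "0 < r2" "ball x0 r2 \<subseteq> W"
    by (auto simp: mem_interior)
  have "isc_at_rel S Q q0 x0"
    by (intro isc) (use assms \<open>q0 \<in> interior V\<close> \<open>x0 \<in> interior W\<close> in \<open>auto dest: subsetD[OF interior_subset]\<close>)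
  \<comment> \<open>Choice of r2/4: for \<open>x\<close> within r2/4 of \<open>x0\<close>, this
    gives \<open>infdist x (S q) < r2 / 2\<close>, so any \<open>y\<close> nearer to
    \<open>x\<close> than \<open>S q\<close> is within 3/4 of \<open>r2\<close> from
    \<open>x0\<close> and hence in \<open>W\<close>.\<close>
  then obtain \<delta> where "0 < \<delta>"
    and \<delta>: "\<And>q. q \<in> Q \<Longrightarrow> dist q q0 < \<delta> \<Longrightarrow> \<exists>x\<in>S q. dist x x0 < r2 / 4"
    using isc_at_relD[of S Q q0 x0 "r2 / 4"] \<open>0 < r2\<close> by auto
  define r where "r = min r1 \<delta>"
  have "S q' \<inter> ball x0 (r2 / 4) \<subseteq> S q + scaled_ball (\<kappa> * norm (q' - q))"
    if q: "q \<in> Q \<inter> ball q0 r" and q': "q' \<in> Q \<inter> ball q0 r" for q q'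
  proof
    fix x assume x: "x \<in> S q' \<inter> ball x0 (r2 / 4)"
    obtain w where w: "w \<in> S q" "dist w x0 < r2 / 4"
      using \<delta>[of q] q by (auto simp: r_def dist_commute)
    have "infdist x (S q) \<le> dist x w"
      using w by (intro infdist_le)
    also have "dist x w \<le> dist x x0 + dist w x0"
      by (rule dist_triangle2)
    finally have infdist_less: "infdist x (S q) < r2 / 2"
      using x w by (simp add: dist_commute)
    have "infdist x (S q) \<le> \<kappa> * norm (q' - q)"
    proof (rule infdist_calm_segment[OF \<open>0 \<le> \<kappa>\<close> \<open>convex Q\<close> closed nonempty calm])
      fix p y
      assume p: "p \<in> closed_segment q' q" and y: "y \<in> S p" "dist x y < infdist x (S q)"
      \<comment> \<open>Balls replace the arbitrary neighborhood \<open>V\<close> so that the whole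
        segment stays where inner semicontinuity is known.\<close>
      have "convex (Q \<inter> ball q0 r)"
        using \<open>convex Q\<close> by (intro convex_Int convex_ball)
      then have "p \<in> Q \<inter> ball q0 r"
        using closed_segment_subset[OF q' q] p by blast
      moreover have "dist x0 y < r2"
        using dist_triangle[of x0 y x] x y infdist_less \<open>0 < r2\<close> by auto
      ultimately show "isc_at_rel S Q p y"
        using isc y \<open>ball q0 r1 \<subseteq> V\<close> \<open>ball x0 r2 \<subseteq> W\<close> by (auto simp: r_def subset_iff)
    qed (use q q' x in auto)
    \<comment> \<open>Attainment in the closed set \<open>S q\<close> yields the inclusion with
      \<open>\<kappa>\<close> itself rather than a slightly larger modulus.\<close>
    moreover obtain z where "z \<in> S q" "infdist x (S q) = dist x z"
      using infdist_attains_inf[OF closed nonempty] q by blast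
    ultimately show "x \<in> S q + scaled_ball (\<kappa> * norm (q' - q))"
      using \<open>0 \<le> \<kappa>\<close> by (auto simp: mem_plus_scaled_ball_iff)
  qed
  moreover have "locally_closed_at (gph S) (q0, x0)"
    using assms(1) by (auto simp: locally_closed_at_def intro!: exI[of _ UNIV])
  ultimately show ?thesis
    unfolding lipschitz_like_rel_def using \<open>0 < r1\<close> \<open>0 < r2\<close> \<open>0 < \<delta>\<close>
    by (intro conjI exI[of _ "ball q0 r"] exI[of _ "ball x0 (r2 / 4)"])
       (auto simp: r_def interior_open)
qed

lemma lipschitz_like_rel_if_locally_lipschitz_rel:
  assumes "locally_lipschitz_rel S Q q0 x0 \<kappa>"
  shows "lipschitz_like_rel S Q q0 x0 \<kappa>"
proof -
  have "(S q \<inter> W) + B \<subseteq> S q + B" for q W B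
    by (intro set_plus_mono2) auto
  then show ?thesis
    using assms unfolding locally_lipschitz_rel_def lipschitz_like_rel_def by (meson subset_trans)
qed

theorem theorem4p7:
  fixes S :: "real ^ 'n \<Rightarrow> (real ^ 'm) set"
    and Q :: "(real ^ 'n) set"
    and \<kappa> :: real
    and q0 :: "real ^ 'n" and x0 :: "real ^ 'm"
  assumes "polyhedral_multifunction S"
    and "convex Q" and "Q \<subseteq> mdom S"
    and "calmness_modulus_on \<kappa> S Q"
    and "(q0, x0) \<in> gph (mrestrict S Q)"
  shows "(isc_around_rel S Q q0 x0 \<longleftrightarrow> lipschitz_like_rel S Q q0 x0 \<kappa>) \<and>
         (locally_lipschitz_rel S Q q0 x0 \<kappa> \<longrightarrow> lipschitz_like_rel S Q q0 x0 \<kappa>)"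
proof -
  have "0 \<le> \<kappa>"
    using assms(4) by (simp add: calmness_modulus_on_def)
  moreover have "q0 \<in> Q" "x0 \<in> S q0"
    using assms(5) by (auto simp: gph_def mrestrict_def split: if_splits)
  ultimately show ?thesis
    using lipschitz_like_rel_if_isc_around_rel[OF closed_gph_polyhedral[OF assms(1)] assms(2-4)]
      isc_around_rel_if_lipschitz_like_rel lipschitz_like_rel_if_locally_lipschitz_rel
    by blast
qed

end
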